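(* For $g\ge0$ and partitions $\alpha$ and $\beta$ of $d\ge1$, the $m$-hypermap number $N^{(g,m)}_{\alpha,\beta}$ is a polynomial in $m$ of degree $r^g_{\alpha,\beta}$, over $\mathbb{Q}$. Moreover, $$\left[\frac{m^{r^g_{\alpha,\beta}}}{r^g_{\alpha,\beta}!}\right]N^{(g,m)}_{\alpha,\beta}=H^g_{\alpha,\beta},$$ where the left-hand side denotes $r^g_{\alpha,\beta}!$ times the coefficient of $m^{r^g_{\alpha,\beta}}$ in $N^{(g,m)}_{\alpha,\beta}$, and $H^g_{\alpha,\beta}$ is the double Hurwitz number.
   Context: For a partition $\alpha$ of $d$, $l(\alpha)$ is the number of parts, $|\mathrm{Aut}\,\alpha|=\prod_{j\ge1}f_j!$, where $f_j$ is the number of parts of $\alpha$ equal to $j$, and $\mathcal{C}_\alpha$ is the conjugacy class of the symmetric group $\mathfrak{S}_d$ consisting of permutations of cycle type $\alpha$. For partitions $\alpha,\beta$ and an integer $g\ge0$, $r^g_{\alpha,\beta}=l(\alpha)+l(\beta)+2g-2$. $m$-hypermap numbers: for a positive integer $m$, $$N^{(g,m)}_{\alpha,\beta}=\frac1{d!}|\mathrm{Aut}\,\alpha|\,|\mathrm{Aut}\,\beta|\;c^{(g,m)}_{\alpha,\beta},$$ where $c^{(g,m)}_{\alpha,\beta}$ is the number of tuples $(\sigma,\gamma,\pi_1,\ldots,\pi_m)$ of permutations in $\mathfrak{S}_d$ with $\sigma\in\mathcal{C}_\alpha$, $\gamma\in\mathcal{C}_\beta$, $\sum_{i=1}^m(d-l(\pi_i))=r^g_{\alpha,\beta}$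 (where $l(\pi_i)$ is the number of cycles in the disjoint cycle decomposition of $\pi_i$, fixed points included), $\sigma\gamma\pi_1\cdots\pi_m$ equal to the identity, and $\langle\sigma,\gamma,\pi_1,\ldots,\pi_m\rangle$ acting transitively on $\{1,\ldots,d\}$. Double Hurwitz numbers: with $r=r^g_{\alpha,\beta}$, $$H^g_{\alpha,\beta}=\frac1{d!}|\mathrm{Aut}\,\alpha|\,|\mathrm{Aut}\,\beta|\;b,$$ where $b$ is the number of tuples $(\sigma,\gamma,\pi_1,\ldots,\pi_r)$ of permutations in $\mathfrak{S}_d$ with $\sigma\in\mathcal{C}_\alpha$, $\gamma\in\mathcal{C}_\beta$, each $\pi_i$ a transposition, $\sigma\gamma\pi_1\cdots\pi_r$ equal to the identity, and $\langle\sigma,\gamma,\pi_1,\ldots,\pi_r\rangle$ acting transitively on $\{1,\ldots,d\}$.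
   Formalization: The degree claim fails for d = 1 and g ≥ 1, where N is zero for all m although r = 2g > 0; the formal statement says the polynomial is zero there and has exact degree r in all other cases, with polynomiality and the coefficient formula kept in every case. *)

theory Defs
  imports
    "HOL-Library.Multiset"
    "HOL-Computational_Algebra.Polynomial"
    "HOL-Combinatorics.Orbits"
    "HOL-Algebra.Sym_Groups"
begin

(* Integer partitions are represented by the multiset of their parts. *)
definition is_partition_of :: "nat multiset \<Rightarrow> nat \<Rightarrow> bool" where
  "is_partition_of \<alpha> d \<longleftrightarrow> 0 \<notin># \<alpha> \<and> sum_mset \<alpha> = d"

definition card_Aut :: "nat multiset \<Rightarrow> nat" where
  "card_Aut \<alpha> = (\<Prod>j\<in>set_mset \<alpha>. fact (count \<alpha> j))"

(* Underlying sets of the cycles of a permutation of {1..d}; a fixed point x gives {x}. *)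
definition cycle_sets :: "nat \<Rightarrow> (nat \<Rightarrow> nat) \<Rightarrow> nat set set" where
  "cycle_sets d \<pi> = Orbits.orbit \<pi> ` {1..d}"

definition num_cycles :: "nat \<Rightarrow> (nat \<Rightarrow> nat) \<Rightarrow> nat" where
  "num_cycles d \<pi> = card (cycle_sets d \<pi>)"

definition cycle_type :: "nat \<Rightarrow> (nat \<Rightarrow> nat) \<Rightarrow> nat multiset" where
  "cycle_type d \<pi> = image_mset card (mset_set (cycle_sets d \<pi>))"

definition perms_of_type :: "nat \<Rightarrow> nat multiset \<Rightarrow> (nat \<Rightarrow> nat) set" where
  "perms_of_type d \<alpha> = {\<pi> \<in> carrier (sym_group d). cycle_type d \<pi> = \<alpha>}"

definition transpositions :: "nat \<Rightarrow> (nat \<Rightarrow> nat) set" where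
  "transpositions d = {transpose a b | a b. a \<in> {1..d} \<and> b \<in> {1..d} \<and> a \<noteq> b}"

definition generates_transitive :: "nat \<Rightarrow> (nat \<Rightarrow> nat) set \<Rightarrow> bool" where
  "generates_transitive d S \<longleftrightarrow>
     (\<forall>x\<in>{1..d}. \<forall>y\<in>{1..d}. \<exists>h\<in>generate (sym_group d) S. h x = y)"

(* Intended for nonempty partitions, where the subtraction does not truncate. *)
definition hurwitz_r :: "nat \<Rightarrow> nat multiset \<Rightarrow> nat multiset \<Rightarrow> nat" where
  "hurwitz_r g \<alpha> \<beta> = size \<alpha> + size \<beta> + 2 * g - 2"

(* The tuple (\<pi>_1, ..., \<pi>_m) is the list \<pi>s, and foldr (\<circ>) \<pi>s id is the product
   of its entries. *)
definition hypermap_tuples ::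
  "nat \<Rightarrow> nat \<Rightarrow> nat \<Rightarrow> nat multiset \<Rightarrow> nat multiset
     \<Rightarrow> ((nat \<Rightarrow> nat) \<times> (nat \<Rightarrow> nat) \<times> (nat \<Rightarrow> nat) list) set" where
  "hypermap_tuples d g m \<alpha> \<beta> =
     {(\<sigma>, \<gamma>, \<pi>s). \<sigma> \<in> perms_of_type d \<alpha> \<and> \<gamma> \<in> perms_of_type d \<beta> \<and>
        length \<pi>s = m \<and> set \<pi>s \<subseteq> carrier (sym_group d) \<and>
        (\<Sum>\<pi>\<leftarrow>\<pi>s. d - num_cycles d \<pi>) = hurwitz_r g \<alpha> \<beta> \<and>
        \<sigma> \<circ> \<gamma> \<circ> foldr (\<circ>) \<pi>s id = id \<and>
        generates_transitive d ({\<sigma>, \<gamma>} \<union> set \<pi>s)}"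

definition hypermap_number ::
  "nat \<Rightarrow> nat \<Rightarrow> nat \<Rightarrow> nat multiset \<Rightarrow> nat multiset \<Rightarrow> rat" where
  "hypermap_number d g m \<alpha> \<beta> =
     1 / fact d * of_nat (card_Aut \<alpha>) * of_nat (card_Aut \<beta>)
       * of_nat (card (hypermap_tuples d g m \<alpha> \<beta>))"

definition hurwitz_tuples ::
  "nat \<Rightarrow> nat \<Rightarrow> nat multiset \<Rightarrow> nat multiset
     \<Rightarrow> ((nat \<Rightarrow> nat) \<times> (nat \<Rightarrow> nat) \<times> (nat \<Rightarrow> nat) list) set" where
  "hurwitz_tuples d g \<alpha> \<beta> =
     {(\<sigma>, \<gamma>, \<pi>s). \<sigma> \<in> perms_of_type d \<alpha> \<and> \<gamma> \<in> perms_of_type d \<beta> \<and>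
        length \<pi>s = hurwitz_r g \<alpha> \<beta> \<and> set \<pi>s \<subseteq> transpositions d \<and>
        \<sigma> \<circ> \<gamma> \<circ> foldr (\<circ>) \<pi>s id = id \<and>
        generates_transitive d ({\<sigma>, \<gamma>} \<union> set \<pi>s)}"

definition double_hurwitz_number ::
  "nat \<Rightarrow> nat \<Rightarrow> nat multiset \<Rightarrow> nat multiset \<Rightarrow> rat" where
  "double_hurwitz_number d g \<alpha> \<beta> =
     1 / fact d * of_nat (card_Aut \<alpha>) * of_nat (card_Aut \<beta>)
       * of_nat (card (hurwitz_tuples d g \<alpha> \<beta>))"

end

theory Submission
  imports Defs
begin

text \<open>
  Polynomiality comes from forgetting the identities among \<open>\<pi>\<^sub>1, \<dots>, \<pi>\<^sub>m\<close>. They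
  contribute nothing to the sum of the defects \<open>d - l(\<pi>\<^sub>i)\<close>, whose prescribed value is \<open>r\<close>,
  nor to the product, nor to the generated group. So a hypermap tuple is the same as a reduced tuple, in which no entry is the identity,
  together with the set of the positions that its \<open>j\<close> entries occupy among the \<open>m\<close>. A
  nonidentity permutation has defect at least \<open>1\<close>, hence \<open>j \<le> r\<close>: there are finitely many
  reduced tuples, and they do not depend on \<open>m\<close>. So the number of hypermap tuples is the sum of
  the binomial coefficients \<open>m choose j\<close> over the reduced tuples (lemma
  \<open>card_hypermap_tuples\<close>), which is a polynomial in \<open>m\<close> of degree at most \<open>r\<close>.

  Only the reduced tuples with \<open>j = r\<close> contribute to the coefficient of \<open>m\<close> to the power \<open>r\<close>,
  each of them \<open>1 / r!\<close>. In such a tuple every entry has defect exactly \<open>1\<close>, that is, it is a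
  transposition; these are the tuples counted by the double Hurwitz number (lemma
  \<open>hurwitz_tuples_eq_reduced\<close>).

  The degree is exactly \<open>r\<close> because the double Hurwitz number does not vanish, except when
  \<open>d = 1\<close> and \<open>g \<ge> 1\<close>, where there is no reduced tuple at all. To construct a Hurwitz tuple,
  the long cycle \<open>c = (1 2 \<dots> d)\<close> is cut into cycles of lengths \<open>\<alpha>\<close> by \<open>l(\<alpha>) - 1\<close>
  transpositions, and likewise for \<open>\<beta>\<close> (lemma \<open>factor_long_cycle\<close>). This gives permutations
  \<open>\<sigma> = a c\<close> of type \<open>\<alpha>\<close> and \<open>\<delta> = b c\<close> of type \<open>\<beta>\<close>, where \<open>a\<close> and \<open>b\<close> are products of
  transpositions. Taking the inverse of \<open>\<delta>\<close> for \<open>\<gamma>\<close> cancels \<open>c\<close>: the product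
  \<open>\<sigma> \<gamma>\<close> is \<open>a\<close> times the inverse of \<open>b\<close>, and the remaining \<open>2 g\<close> transpositions are spent on
  repeating a single one. The generated group is transitive since it contains \<open>c\<close>.
\<close>

section \<open>Inserting identities into a list of permutations\<close>

text \<open>
  The polynomial with values \<open>m choose j\<close>. Its degree and leading coefficient are what determine
  the top coefficient of the hypermap number.
\<close>

definition binomial_poly :: "nat \<Rightarrow> rat poly" where
  "binomial_poly j = smult (1 / fact j) (\<Prod>i<j. [:- of_nat i, 1:])"

lemma poly_binomial_poly: "poly (binomial_poly j) (of_nat m) = of_nat (m choose j)"
proof -
  have "poly (binomial_poly j) (of_nat m) = (\<Prod>i<j. of_nat m - of_nat i) / (fact j :: rat)"
    by (simp add: binomial_poly_def poly_prod)
  also have "\<dots> = of_nat m gchoose j"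
    by (simp add: gbinomial_prod_rev atLeast0LessThan)
  finally show ?thesis
    by (simp add: binomial_gbinomial)
qed

lemma degree_binomial_poly: "degree (binomial_poly j) = j"
  by (simp add: binomial_poly_def degree_prod_eq_sum_degree)

lemma lead_coeff_binomial_poly: "coeff (binomial_poly j) j = 1 / fact j"
proof -
  have "lead_coeff (binomial_poly j) = 1 / fact j"
    unfolding binomial_poly_def lead_coeff_smult lead_coeff_prod by simp
  then show ?thesis by (simp add: degree_binomial_poly)
qed

text \<open>
  A list is recovered from its entries other than \<open>e\<close> and from the positions of those entries.
  The induction on the length realises this as Pascal's rule: the first entry is either \<open>e\<close> or
  the first element of \<open>ys\<close>.
\<close>

lemma card_lists_with_filter:
  assumes "e \<notin> set ys"
  shows "finite {xs. length xs = m \<and> filter (\<lambda>x. x \<noteq> e) xs = ys} \<and>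
         card {xs. length xs = m \<and> filter (\<lambda>x. x \<noteq> e) xs = ys} = m choose length ys"
  using assms
proof (induction m arbitrary: ys)
  case 0
  have "{xs. length xs = 0 \<and> filter (\<lambda>x. x \<noteq> e) xs = ys} = (if ys = [] then {[]} else {})"
    by auto
  then show ?case by (cases ys) auto
next
  case (Suc m)
  let ?L = "\<lambda>m ys. {xs. length xs = m \<and> filter (\<lambda>x. x \<noteq> e) xs = ys}"
  show ?case
  proof (cases ys)
    case Nil
    have "?L (Suc m) ys = (#) e ` ?L m []"
      by (auto simp: length_Suc_conv Nil split: if_splits)
    then show ?thesis using Suc.IH[of "[]"] Nil by (simp add: card_image)
  next
    case (Cons y zs)
    have "?L (Suc m) ys = (#) e ` ?L m ys \<union> (#) y ` ?L m zs"
      using Suc.prems by (auto simp: length_Suc_conv Cons split: if_splits)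
    moreover have "(#) e ` ?L m ys \<inter> (#) y ` ?L m zs = {}"
      using Suc.prems Cons by auto
    ultimately show ?thesis using Suc.IH[of ys] Suc.IH[of zs] Suc.prems Cons
      by (simp add: card_image card_Un_disjoint)
  qed
qed

lemma foldr_comp_filter_id: "foldr (\<circ>) (filter (\<lambda>\<pi>. \<pi> \<noteq> id) \<pi>s) id = foldr (\<circ>) \<pi>s id"
  by (induction \<pi>s) auto

lemma foldr_comp_append: "foldr (\<circ>) (xs @ ys) id = foldr (\<circ>) xs id \<circ> foldr (\<circ>) ys id"
  by (induction xs) (auto simp: comp_assoc)

lemma generates_transitive_mono_id:
  assumes "generates_transitive d S" "S \<subseteq> insert id T"
  shows "generates_transitive d T"
proof -
  interpret G: group "sym_group d" by (rule sym_group_is_group)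
  have "generate (sym_group d) S \<subseteq> generate (sym_group d) T"
  proof
    fix h assume "h \<in> generate (sym_group d) S"
    then show "h \<in> generate (sym_group d) T"
    proof induction
      case one
      show ?case by (rule generate.one)
    next
      case (incl h)
      then show ?case using assms(2) generate.one[of "sym_group d" T]
        by (auto simp: sym_group_one intro: generate.incl)
    next
      case (inv h)
      show ?case
      proof (cases "h = \<one>\<^bsub>sym_group d\<^esub>")
        case True
        then show ?thesis by (simp add: generate.one)
      next
        case False
        then show ?thesis using inv assms(2)
          by (auto simp: sym_group_one intro: generate.inv)
      qed
    next
      case (eng h1 h2)
      show ?case using eng.IH by (rule generate.eng)
    qed
  qed
  then show ?thesis using assms(1) unfolding generates_transitive_def by blast
qed

section \<open>Cycle counts of the identity and of transpositions\<close>

lemma orbit_step_eq: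
  assumes "\<pi> permutes {1..d::nat}"
  shows "Orbits.orbit \<pi> (\<pi> x) = Orbits.orbit \<pi> x"
  by (intro permutation_orbit_step permutes_imp_permutation[OF _ assms]) simp

lemma num_cycles_le: "num_cycles d \<pi> \<le> d"
  unfolding num_cycles_def cycle_sets_def using card_image_le[of "{1..d}"] by simp

lemma num_cycles_id: "num_cycles d id = d"
proof -
  have "inj_on (Orbits.orbit (id :: nat \<Rightarrow> nat)) {1..d}"
    by (auto simp: inj_on_def orbit_eq_singleton_iff[THEN iffD2])
  then show ?thesis
    unfolding num_cycles_def cycle_sets_def by (simp add: card_image)
qed

text \<open>
  If there are \<open>d\<close> cycles, then distinct points lie on distinct cycles. Since \<open>\<pi> x\<close> lies on the
  cycle of \<open>x\<close>, every point is fixed.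
\<close>

lemma num_cycles_less:
  assumes "\<pi> permutes {1..d}" "\<pi> \<noteq> id"
  shows "num_cycles d \<pi> < d"
proof (rule ccontr)
  assume "\<not> num_cycles d \<pi> < d"
  then have "card (Orbits.orbit \<pi> ` {1..d}) = card {1..d}"
    using num_cycles_le[of d \<pi>] unfolding num_cycles_def cycle_sets_def by simp
  then have inj: "inj_on (Orbits.orbit \<pi>) {1..d}"
    by (intro eq_card_imp_inj_on) auto
  have "\<pi> x = x" for x
  proof (cases "x \<in> {1..d}")
    case True
    then show ?thesis
      using inj_onD[OF inj, OF orbit_step_eq[OF assms(1)]] permutes_in_image[OF assms(1)] by blast
  next
    case False
    then show ?thesis using assms(1) by (simp add: permutes_not_in)
  qed
  then show False using assms(2) by auto
qed

text \<open>
  Choose \<open>a\<close> with \<open>b = \<pi> a \<noteq> a\<close>. The points \<open>a\<close> and \<open>b\<close> share a cycle, so the \<open>d - 1\<close> points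
  other than \<open>b\<close> already meet all \<open>d - 1\<close> cycles, and no two of them share one. Therefore \<open>\<pi>\<close>
  fixes each point whose image is not \<open>b\<close>, apart from \<open>b\<close> itself.
\<close>

lemma transposition_if_num_cycles:
  assumes \<pi>: "\<pi> permutes {1..d}" and num: "d - num_cycles d \<pi> = 1"
  shows "\<pi> \<in> transpositions d"
proof -
  have "\<pi> \<noteq> id" using num num_cycles_id[of d] by auto
  then have "\<exists>a. \<pi> a \<noteq> a" by (simp add: fun_eq_iff)
  then obtain a where a: "\<pi> a \<noteq> a" ..
  define b where "b = \<pi> a"
  have inj_\<pi>: "inj \<pi>" using \<pi> by (rule permutes_inj)
  have "a \<in> {1..d}" using a permutes_not_in[OF \<pi>] by blast
  moreover have "b \<in> {1..d}"
    unfolding b_def permutes_in_image[OF \<pi>] by fact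
  ultimately have ab: "a \<in> {1..d}" "b \<in> {1..d}" "a \<noteq> b"
    using a by (simp_all add: b_def)
  have "Orbits.orbit \<pi> b = Orbits.orbit \<pi> a"
    unfolding b_def by (rule orbit_step_eq[OF \<pi>])
  then have "Orbits.orbit \<pi> b \<in> Orbits.orbit \<pi> ` ({1..d} - {b})"
    using ab(1,3) by blast
  then have "insert (Orbits.orbit \<pi> b) (Orbits.orbit \<pi> ` ({1..d} - {b})) =
             Orbits.orbit \<pi> ` ({1..d} - {b})"
    by (rule insert_absorb)
  moreover have "{1..d} = insert b ({1..d} - {b})" using ab(2) by blast
  ultimately have "Orbits.orbit \<pi> ` {1..d} = Orbits.orbit \<pi> ` ({1..d} - {b})"
    by (metis image_insert)
  then have "card (Orbits.orbit \<pi> ` ({1..d} - {b})) = card ({1..d} - {b})"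
    using num ab unfolding num_cycles_def cycle_sets_def by simp
  then have inj: "inj_on (Orbits.orbit \<pi>) ({1..d} - {b})"
    by (intro eq_card_imp_inj_on) auto
  have fixed: "\<pi> x = x" if "x \<noteq> a" "x \<noteq> b" for x
  proof (cases "x \<in> {1..d}")
    case True
    have "\<pi> x \<noteq> b" using that(1) unfolding b_def inj_eq[OF inj_\<pi>] .
    moreover have "\<pi> x \<in> {1..d}" using True permutes_in_image[OF \<pi>] by blast
    ultimately show ?thesis
      using True that(2) inj_onD[OF inj, OF orbit_step_eq[OF \<pi>]] by blast
  next
    case False
    then show ?thesis using \<pi> by (simp add: permutes_not_in)
  qed
  have "\<pi> b = a"
  proof (rule ccontr)
    assume "\<pi> b \<noteq> a"
    moreover have "\<pi> b \<noteq> b" using a unfolding b_def inj_eq[OF inj_\<pi>] .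
    ultimately have "\<pi> (\<pi> b) = \<pi> b" by (rule fixed)
    then have "\<pi> b = b" unfolding inj_eq[OF inj_\<pi>] .
    with \<open>\<pi> b \<noteq> b\<close> show False by contradiction
  qed
  have "\<pi> = transpose a b"
  proof
    fix x
    consider "x = a" | "x = b" | "x \<noteq> a" "x \<noteq> b" by blast
    then show "\<pi> x = transpose a b x"
    proof cases
      case 1
      then show ?thesis by (simp add: b_def)
    next
      case 2
      then show ?thesis using \<open>\<pi> b = a\<close> by simp
    next
      case 3
      then show ?thesis using fixed by simp
    qed
  qed
  then show ?thesis using ab unfolding transpositions_def by auto
qed

lemma transposition_properties:
  assumes "\<tau> \<in> transpositions d"
  shows "\<tau> permutes {1..d}" "\<tau> \<noteq> id" "\<tau> \<circ> \<tau> = id" "d - num_cycles d \<tau> = 1"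
proof -
  obtain a b where ab: "a \<in> {1..d}" "b \<in> {1..d}" "a \<noteq> b" and \<tau>: "\<tau> = transpose a b"
    using assms unfolding transpositions_def by auto
  show perm: "\<tau> permutes {1..d}" unfolding \<tau> using ab by (intro permutes_swap_id)
  show neq: "\<tau> \<noteq> id" using ab by (auto simp: \<tau> transpose_def fun_eq_iff)
  show "\<tau> \<circ> \<tau> = id" by (simp add: \<tau>)
  have sing: "Orbits.orbit \<tau> x = {x}" if "x \<noteq> a" "x \<noteq> b" for x
    using that by (simp add: orbit_eq_singleton_iff \<tau>)
  have self: "x \<in> Orbits.orbit \<tau> x" for x
    by (intro permutation_self_in_orbit permutes_imp_permutation[OF _ perm]) simp
  have "inj_on (Orbits.orbit \<tau>) ({1..d} - {b})"
  proof (rule inj_onI)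
    fix x y
    assume xy: "x \<in> {1..d} - {b}" "y \<in> {1..d} - {b}"
      and eq: "Orbits.orbit \<tau> x = Orbits.orbit \<tau> y"
    show "x = y"
    proof (cases "x = a")
      case False
      then have "Orbits.orbit \<tau> y = {x}" using xy(1) sing[of x] unfolding eq by blast
      then show ?thesis using self[of y] by simp
    next
      case x: True
      show ?thesis
      proof (cases "y = a")
        case False
        then have "Orbits.orbit \<tau> x = {y}" using xy(2) sing[of y] unfolding eq by blast
        then show ?thesis using self[of x] by simp
      qed (simp add: x)
    qed
  qed
  then have "d - 1 = card (Orbits.orbit \<tau> ` ({1..d} - {b}))"
    using ab by (simp add: card_image)
  also have "\<dots> \<le> num_cycles d \<tau>"
    unfolding num_cycles_def cycle_sets_def by (intro card_mono image_mono) auto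
  finally show "d - num_cycles d \<tau> = 1"
    using num_cycles_less[OF perm neq] by simp
qed

section \<open>Polynomiality\<close>

text \<open>
  The list has no prescribed length: this makes the set independent of \<open>m\<close>, and it is finite
  because the defect \<open>r\<close> bounds the length.
\<close>

definition reduced_tuples ::
  "nat \<Rightarrow> nat \<Rightarrow> nat multiset \<Rightarrow> nat multiset
     \<Rightarrow> ((nat \<Rightarrow> nat) \<times> (nat \<Rightarrow> nat) \<times> (nat \<Rightarrow> nat) list) set" where
  "reduced_tuples d r \<alpha> \<beta> =
     {(\<sigma>, \<gamma>, \<rho>s). \<sigma> \<in> perms_of_type d \<alpha> \<and> \<gamma> \<in> perms_of_type d \<beta> \<and>
        set \<rho>s \<subseteq> carrier (sym_group d) - {id} \<and>
        (\<Sum>\<rho>\<leftarrow>\<rho>s. d - num_cycles d \<rho>) = r \<and>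
        \<sigma> \<circ> \<gamma> \<circ> foldr (\<circ>) \<rho>s id = id \<and>
        generates_transitive d ({\<sigma>, \<gamma>} \<union> set \<rho>s)}"

lemma length_le_defect:
  assumes "set \<rho>s \<subseteq> carrier (sym_group d) - {id}"
  shows "length \<rho>s \<le> (\<Sum>\<rho>\<leftarrow>\<rho>s. d - num_cycles d \<rho>)"
  using assms
proof (induction \<rho>s)
  case (Cons \<rho> \<rho>s)
  then have "num_cycles d \<rho> < d"
    by (intro num_cycles_less) (auto simp: sym_group_carrier)
  then show ?case using Cons by simp
qed simp

text \<open>
  All summands are at least \<open>1\<close>, so equality forces each of them to be \<open>1\<close>.
\<close>

lemma length_eq_defect_iff:
  assumes "set \<rho>s \<subseteq> carrier (sym_group d) - {id}"
  shows "length \<rho>s = (\<Sum>\<rho>\<leftarrow>\<rho>s. d - num_cycles d \<rho>) \<longleftrightarrow> set \<rho>s \<subseteq> transpositions d"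
  using assms
proof (induction \<rho>s)
  case (Cons \<rho> \<rho>s)
  have tail: "set \<rho>s \<subseteq> carrier (sym_group d) - {id}"
    using Cons.prems by (simp only: list.set insert_subset)
  have \<rho>: "\<rho> permutes {1..d}" "\<rho> \<noteq> id" using Cons.prems by (auto simp: sym_group_carrier)
  have "d - num_cycles d \<rho> = 1 \<longleftrightarrow> \<rho> \<in> transpositions d"
    using \<rho>(1) transposition_if_num_cycles transposition_properties(4) by blast
  moreover have "num_cycles d \<rho> < d" using \<rho> by (rule num_cycles_less)
  moreover have "length \<rho>s \<le> (\<Sum>\<rho>\<leftarrow>\<rho>s. d - num_cycles d \<rho>)"
    using tail by (rule length_le_defect)
  moreover have "length \<rho>s = (\<Sum>\<rho>\<leftarrow>\<rho>s. d - num_cycles d \<rho>) \<longleftrightarrow> set \<rho>s \<subseteq> transpositions d"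
    using tail by (rule Cons.IH)
  ultimately show ?case by auto
qed simp

lemma finite_sym_group: "finite (carrier (sym_group d))"
  unfolding sym_group_def by (simp add: finite_permutations)

lemma finite_reduced_tuples: "finite (reduced_tuples d r \<alpha> \<beta>)"
proof -
  let ?C = "carrier (sym_group d)"
  have "reduced_tuples d r \<alpha> \<beta> \<subseteq> ?C \<times> ?C \<times> {\<rho>s. set \<rho>s \<subseteq> ?C \<and> length \<rho>s \<le> r}"
    using length_le_defect by (fastforce simp: reduced_tuples_def perms_of_type_def)
  moreover have "finite (?C \<times> ?C \<times> {\<rho>s. set \<rho>s \<subseteq> ?C \<and> length \<rho>s \<le> r})"
    by (intro finite_cartesian_product finite_sym_group finite_lists_length_le)
  ultimately show ?thesis by (rule finite_subset)
qed

lemma hurwitz_tuples_eq_reduced: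
  "hurwitz_tuples d g \<alpha> \<beta> =
     {t \<in> reduced_tuples d (hurwitz_r g \<alpha> \<beta>) \<alpha> \<beta>. length (snd (snd t)) = hurwitz_r g \<alpha> \<beta>}"
proof -
  have sub: "set \<rho>s \<subseteq> transpositions d \<Longrightarrow> set \<rho>s \<subseteq> carrier (sym_group d) - {id}" for \<rho>s
    using transposition_properties(1,2) sym_group_carrier by blast
  have iff: "set \<rho>s \<subseteq> transpositions d \<and> length \<rho>s = r \<longleftrightarrow>
        set \<rho>s \<subseteq> carrier (sym_group d) - {id} \<and> (\<Sum>\<rho>\<leftarrow>\<rho>s. d - num_cycles d \<rho>) = r \<and> length \<rho>s = r"
    for \<rho>s r
    using sub[of \<rho>s] length_eq_defect_iff[of \<rho>s d] by auto
  show ?thesis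
  proof (rule Set.set_eqI)
    fix t :: "(nat \<Rightarrow> nat) \<times> (nat \<Rightarrow> nat) \<times> (nat \<Rightarrow> nat) list"
    obtain \<sigma> \<gamma> \<rho>s where t: "t = (\<sigma>, \<gamma>, \<rho>s)" by (cases t)
    show "t \<in> hurwitz_tuples d g \<alpha> \<beta> \<longleftrightarrow>
      t \<in> {t \<in> reduced_tuples d (hurwitz_r g \<alpha> \<beta>) \<alpha> \<beta>. length (snd (snd t)) = hurwitz_r g \<alpha> \<beta>}"
      using iff[of \<rho>s "hurwitz_r g \<alpha> \<beta>"]
      unfolding hurwitz_tuples_def reduced_tuples_def t mem_Collect_eq case_prod_conv prod.sel
      by blast
  qed
qed

lemma sum_defect_filter_id:
  "(\<Sum>\<pi>\<leftarrow>filter (\<lambda>\<pi>. \<pi> \<noteq> id) \<pi>s. d - num_cycles d \<pi>) = (\<Sum>\<pi>\<leftarrow>\<pi>s. d - num_cycles d \<pi>)"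
  by (induction \<pi>s) (auto simp: num_cycles_id num_cycles_id[unfolded id_def])

lemma hypermap_tuples_iff_reduced:
  "(\<sigma>, \<gamma>, \<pi>s) \<in> hypermap_tuples d g m \<alpha> \<beta> \<longleftrightarrow>
     length \<pi>s = m \<and>
     (\<sigma>, \<gamma>, filter (\<lambda>\<pi>. \<pi> \<noteq> id) \<pi>s) \<in> reduced_tuples d (hurwitz_r g \<alpha> \<beta>) \<alpha> \<beta>"
proof -
  let ?\<rho>s = "filter (\<lambda>\<pi>. \<pi> \<noteq> id) \<pi>s"
  have "id \<in> carrier (sym_group d)" by (simp add: sym_group_carrier permutes_id)
  then have "set \<pi>s \<subseteq> carrier (sym_group d) \<longleftrightarrow> set ?\<rho>s \<subseteq> carrier (sym_group d) - {id}"
    by auto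
  moreover have "generates_transitive d ({\<sigma>, \<gamma>} \<union> set \<pi>s) \<longleftrightarrow>
                 generates_transitive d ({\<sigma>, \<gamma>} \<union> set ?\<rho>s)"
    by (auto elim!: generates_transitive_mono_id)
  ultimately show ?thesis
    unfolding hypermap_tuples_def reduced_tuples_def
    by (auto simp: foldr_comp_filter_id sum_defect_filter_id)
qed

text \<open>
  Deleting the identities maps hypermap tuples onto those reduced tuples that are short enough;
  the fibres, called \<open>F\<close> in the proof, are counted by binomial coefficients, which vanish when the
  reduced tuple is longer than \<open>m\<close>.
\<close>

lemma card_hypermap_tuples:
  "card (hypermap_tuples d g m \<alpha> \<beta>) =
     (\<Sum>t\<in>reduced_tuples d (hurwitz_r g \<alpha> \<beta>) \<alpha> \<beta>. m choose length (snd (snd t)))"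
proof -
  let ?R = "reduced_tuples d (hurwitz_r g \<alpha> \<beta>) \<alpha> \<beta>"
  define F where "F = (\<lambda>t :: (nat \<Rightarrow> nat) \<times> (nat \<Rightarrow> nat) \<times> (nat \<Rightarrow> nat) list.
    (\<lambda>\<pi>s. (fst t, fst (snd t), \<pi>s)) `
      {\<pi>s. length \<pi>s = m \<and> filter (\<lambda>\<pi>. \<pi> \<noteq> id) \<pi>s = snd (snd t)})"
  have F: "finite (F t) \<and> card (F t) = m choose length (snd (snd t))" if "t \<in> ?R" for t
  proof -
    have "id \<notin> set (snd (snd t))" using that by (auto simp: reduced_tuples_def)
    then show ?thesis unfolding F_def
      using card_lists_with_filter[of id "snd (snd t)" m] by (simp add: card_image inj_on_def)
  qed
  have "hypermap_tuples d g m \<alpha> \<beta> = (\<Union>t\<in>?R. F t)"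
    unfolding F_def by (auto simp: hypermap_tuples_iff_reduced image_iff)
  moreover have "card (\<Union>t\<in>?R. F t) = (\<Sum>t\<in>?R. card (F t))"
  proof (rule card_UN_disjoint)
    show "finite ?R" by (rule finite_reduced_tuples)
    show "\<forall>t\<in>?R. finite (F t)" using F by blast
    show "\<forall>t\<in>?R. \<forall>u\<in>?R. t \<noteq> u \<longrightarrow> F t \<inter> F u = {}" unfolding F_def by auto
  qed
  ultimately show ?thesis using F by simp
qed

section \<open>Nonvanishing of double Hurwitz numbers\<close>

text \<open>
  The cycle \<open>(a+1 a+2 \<dots> a+k)\<close>. The condition \<open>0 < k\<close> makes it the identity for \<open>k = 0\<close>, where
  \<open>a\<close> would otherwise be sent to \<open>Suc a\<close>.
\<close>

definition interval_cycle :: "nat \<Rightarrow> nat \<Rightarrow> nat \<Rightarrow> nat" where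
  "interval_cycle a k x =
     (if a < x \<and> x < a + k then Suc x else if 0 < k \<and> x = a + k then Suc a else x)"

lemma interval_cycle_permutes: "interval_cycle a k permutes {Suc a..a + k}"
proof (rule bij_imp_permutes)
  have "inj_on (interval_cycle a k) {Suc a..a + k}"
    by (auto simp: inj_on_def interval_cycle_def)
  moreover have "interval_cycle a k ` {Suc a..a + k} \<subseteq> {Suc a..a + k}"
    by (auto simp: interval_cycle_def)
  ultimately show "bij_betw (interval_cycle a k) {Suc a..a + k} {Suc a..a + k}"
    by (simp add: bij_betw_def endo_inj_surj)
qed (auto simp: interval_cycle_def)

lemma orbit_interval_cycle:
  assumes "x \<in> {Suc a..a + k}"
  shows "Orbits.orbit (interval_cycle a k) x = {Suc a..a + k}"
proof -
  let ?c = "interval_cycle a k"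
  have pow: "(?c ^^ Suc n) (a + k) = a + Suc n" if "n < k" for n
    using that by (induction n) (auto simp: interval_cycle_def)
  have top: "a + k \<in> {Suc a..a + k}" using assms by simp
  have "{Suc a..a + k} \<subseteq> Orbits.orbit ?c (a + k)"
  proof
    fix y assume y: "y \<in> {Suc a..a + k}"
    then have "y = (?c ^^ Suc (y - Suc a)) (a + k)" using pow[of "y - Suc a"] by auto
    then show "y \<in> Orbits.orbit ?c (a + k)" unfolding orbit_altdef by blast
  qed
  moreover have "Orbits.orbit ?c (a + k) \<subseteq> {Suc a..a + k}"
    by (rule permutes_orbit_subset[OF interval_cycle_permutes top])
  ultimately have "cyclic_on ?c {Suc a..a + k}"
    using top unfolding cyclic_on_def by blast
  then show ?thesis using assms by (rule orbit_cyclic_eq3)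
qed

text \<open>
  The two factors move disjoint sets of points, so the cycles of the product are those of \<open>\<sigma>\<close>
  and one new cycle of length \<open>k\<close>.
\<close>

lemma cycle_type_comp_interval_cycle:
  assumes \<sigma>: "\<sigma> permutes {1..n}" and "0 < k"
  shows "cycle_type (n + k) (\<sigma> \<circ> interval_cycle n k) = add_mset k (cycle_type n \<sigma>)"
proof -
  let ?b = "interval_cycle n k" and ?B = "{Suc n..n + k}"
  have old: "Orbits.orbit (\<sigma> \<circ> ?b) x = Orbits.orbit \<sigma> x" if x: "x \<in> {1..n}" for x
  proof (rule orbit_cong0[OF x, symmetric])
    show "\<sigma> \<in> {1..n} \<rightarrow> {1..n}" using permutes_in_image[OF \<sigma>] by blast
  qed (auto simp: interval_cycle_def)
  have new: "Orbits.orbit (\<sigma> \<circ> ?b) x = ?B" if x: "x \<in> ?B" for x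
  proof -
    have "Orbits.orbit ?b x = Orbits.orbit (\<sigma> \<circ> ?b) x"
    proof (rule orbit_cong0[OF x])
      show "?b \<in> ?B \<rightarrow> ?B" using permutes_in_image[OF interval_cycle_permutes] by blast
      show "?b y = (\<sigma> \<circ> ?b) y" if "y \<in> ?B" for y
      proof -
        have "?b y \<in> ?B" using that permutes_in_image[OF interval_cycle_permutes] by blast
        then show ?thesis using permutes_not_in[OF \<sigma>, of "?b y"] by simp
      qed
    qed
    then show ?thesis using orbit_interval_cycle[OF x] by simp
  qed
  have split: "{1..n + k} = {1..n} \<union> ?B" by auto
  have "Orbits.orbit (\<sigma> \<circ> ?b) ` {1..n} = Orbits.orbit \<sigma> ` {1..n}"
    using old by (rule image_cong[OF refl])
  moreover have "Orbits.orbit (\<sigma> \<circ> ?b) ` ?B = (\<lambda>_. ?B) ` ?B"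
    using new by (rule image_cong[OF refl])
  moreover have "(\<lambda>_. ?B) ` ?B = {?B}" using \<open>0 < k\<close> by (simp add: image_constant_conv)
  ultimately have "cycle_sets (n + k) (\<sigma> \<circ> ?b) = insert ?B (cycle_sets n \<sigma>)"
    unfolding cycle_sets_def split image_Un by simp
  moreover have "?B \<notin> cycle_sets n \<sigma>"
  proof
    assume "?B \<in> cycle_sets n \<sigma>"
    then obtain x where "x \<in> {1..n}" "Orbits.orbit \<sigma> x = ?B" unfolding cycle_sets_def by auto
    then have "?B \<subseteq> {1..n}" using permutes_orbit_subset[OF \<sigma>] by blast
    then show False using \<open>0 < k\<close> by auto
  qed
  moreover have "finite (cycle_sets n \<sigma>)" unfolding cycle_sets_def by simp
  ultimately show ?thesis unfolding cycle_type_def by simp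
qed

lemma interval_cycle_join:
  assumes "0 < n" "0 < k"
  shows "interval_cycle 0 n \<circ> interval_cycle n k = transpose 1 (Suc n) \<circ> interval_cycle 0 (n + k)"
  using assms by (auto simp: fun_eq_iff interval_cycle_def transpose_def)

text \<open>
  The parts are split off one at a time by \<open>interval_cycle_join\<close>: each part after the first
  costs one transposition.
\<close>

lemma factor_long_cycle:
  assumes "\<alpha> \<noteq> {#}" "0 \<notin># \<alpha>"
  shows "\<exists>\<sigma> T. \<sigma> \<in> perms_of_type (sum_mset \<alpha>) \<alpha> \<and> set T \<subseteq> transpositions (sum_mset \<alpha>) \<and>
           Suc (length T) = size \<alpha> \<and> \<sigma> = foldr (\<circ>) T id \<circ> interval_cycle 0 (sum_mset \<alpha>)"
  using assms
proof (induction \<alpha>)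
  case (add k \<alpha>)
  let ?n = "sum_mset \<alpha>"
  have k: "0 < k" using add.prems by (auto intro: gr0I)
  show ?case
  proof (cases "\<alpha> = {#}")
    case True
    have "cycle_type 0 id = {#}" by (simp add: cycle_type_def cycle_sets_def)
    then have "cycle_type k (interval_cycle 0 k) = {#k#}"
      using cycle_type_comp_interval_cycle[of id 0 k] k by (simp add: permutes_id)
    then show ?thesis using True interval_cycle_permutes[of 0 k]
      by (intro exI[of _ "interval_cycle 0 k"] exI[of _ "[]"])
         (simp add: perms_of_type_def sym_group_carrier)
  next
    case False
    then have "\<exists>\<sigma> T. \<sigma> \<in> perms_of_type ?n \<alpha> \<and> set T \<subseteq> transpositions ?n \<and>
        Suc (length T) = size \<alpha> \<and> \<sigma> = foldr (\<circ>) T id \<circ> interval_cycle 0 ?n"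
      using add.prems by (intro add.IH) auto
    then obtain \<sigma> T where \<sigma>: "\<sigma> \<in> perms_of_type ?n \<alpha>" and T: "set T \<subseteq> transpositions ?n"
      and len: "Suc (length T) = size \<alpha>" and eq: "\<sigma> = foldr (\<circ>) T id \<circ> interval_cycle 0 ?n"
      by blast
    obtain x where "x \<in># \<alpha>" using False by (rule multiset_nonemptyE)
    moreover from this have "x \<noteq> 0" using add.prems(2) by (cases "x = 0") auto
    ultimately have n: "0 < ?n" by (metis gr0I sum_mset_0_iff)
    have \<sigma>_perm: "\<sigma> permutes {1..?n}" and type: "cycle_type ?n \<sigma> = \<alpha>"
      using \<sigma> by (auto simp: perms_of_type_def sym_group_carrier)
    let ?b = "interval_cycle ?n k" and ?\<tau> = "transpose 1 (Suc ?n)"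
    have "interval_cycle 0 ?n \<circ> ?b = ?\<tau> \<circ> interval_cycle 0 (?n + k)"
      using n k by (rule interval_cycle_join)
    then have "\<sigma> \<circ> ?b = foldr (\<circ>) (T @ [?\<tau>]) id \<circ> interval_cycle 0 (?n + k)"
      by (simp only: eq foldr_comp_append) (simp add: comp_assoc)
    moreover have "\<sigma> \<circ> ?b \<in> perms_of_type (?n + k) (add_mset k \<alpha>)"
    proof -
      have "?b permutes {1..?n + k}"
        by (rule permutes_subset[OF interval_cycle_permutes]) auto
      moreover have "\<sigma> permutes {1..?n + k}"
        by (rule permutes_subset[OF \<sigma>_perm]) auto
      ultimately show ?thesis
        using cycle_type_comp_interval_cycle[OF \<sigma>_perm k] type
        by (simp add: perms_of_type_def sym_group_carrier permutes_compose)
    qed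
    moreover have "set (T @ [?\<tau>]) \<subseteq> transpositions (?n + k)"
    proof -
      have "transpositions ?n \<subseteq> transpositions (?n + k)"
        unfolding transpositions_def by fastforce
      moreover have "?\<tau> \<in> transpositions (?n + k)"
      proof -
        have "1 \<in> {1..?n + k}" "Suc ?n \<in> {1..?n + k}" using k by simp_all
        moreover have "1 \<noteq> Suc ?n" using n by linarith
        ultimately show ?thesis unfolding transpositions_def by blast
      qed
      ultimately show ?thesis using T by auto
    qed
    moreover have "Suc (length (T @ [?\<tau>])) = size (add_mset k \<alpha>)" using len by simp
    moreover have sum: "sum_mset (add_mset k \<alpha>) = ?n + k" by simp
    ultimately show ?thesis unfolding sum by blast
  qed
qed simp

lemma inv_perms_of_type:
  assumes "\<sigma> \<in> perms_of_type d \<alpha>"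
  shows "inv' \<sigma> \<in> perms_of_type d \<alpha>"
proof -
  have \<sigma>: "\<sigma> permutes {1..d}" using assms by (simp add: perms_of_type_def sym_group_carrier)
  have "Orbits.orbit (inv' \<sigma>) = Orbits.orbit \<sigma>"
    by (intro ext orbit_inv_eq permutes_imp_permutation[OF _ \<sigma>]) simp
  then show ?thesis using assms permutes_inv[OF \<sigma>]
    by (simp add: perms_of_type_def sym_group_carrier cycle_type_def cycle_sets_def)
qed

text \<open>
  Transpositions are involutions, so reversing a list of them inverts its product.
\<close>

lemma foldr_transpositions:
  assumes "set T \<subseteq> transpositions d"
  shows "foldr (\<circ>) T id permutes {1..d}" "foldr (\<circ>) (rev T) id = inv' (foldr (\<circ>) T id)"
proof -
  show perm: "foldr (\<circ>) T id permutes {1..d}" using assms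
    by (induction T)
       (simp_all add: permutes_id permutes_compose transposition_properties(1) del: One_nat_def)
  have "foldr (\<circ>) T id \<circ> foldr (\<circ>) (rev T) id = id" using assms
  proof (induction T)
    case (Cons \<tau> T)
    have "foldr (\<circ>) (\<tau> # T) id \<circ> foldr (\<circ>) (rev (\<tau> # T)) id =
          \<tau> \<circ> (foldr (\<circ>) T id \<circ> foldr (\<circ>) (rev T) id) \<circ> \<tau>"
      by (simp only: rev.simps foldr_comp_append) (simp add: comp_assoc)
    also have "foldr (\<circ>) T id \<circ> foldr (\<circ>) (rev T) id = id"
      using Cons.prems by (intro Cons.IH) simp
    also have "\<tau> \<circ> id \<circ> \<tau> = id"
      using Cons.prems transposition_properties(3)[of \<tau> d] by simp
    finally show ?case .
  qed simp
  then show "foldr (\<circ>) (rev T) id = inv' (foldr (\<circ>) T id)"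
    by (metis comp_assoc comp_id id_comp permutes_inv_o(2)[OF perm])
qed

text \<open>
  Multiplying \<open>\<sigma>\<close> by the inverse of the product of \<open>T\<close> shows that the long cycle lies in the
  generated group, and its powers move any point to any other.
\<close>

lemma generates_transitive_long_cycle:
  assumes S: "S \<subseteq> carrier (sym_group d)" and \<sigma>: "\<sigma> \<in> S" and TS: "set T \<subseteq> S"
    and T: "set T \<subseteq> transpositions d"
    and eq: "\<sigma> = foldr (\<circ>) T id \<circ> interval_cycle 0 d"
  shows "generates_transitive d S"
proof -
  let ?c = "interval_cycle 0 d" and ?G = "generate (sym_group d) S"
  have mult: "f \<circ> h \<in> ?G" if "f \<in> ?G" "h \<in> ?G" for f h
    using generate.eng[OF that] by (simp add: sym_group_mult)
  have one: "id \<in> ?G" using generate.one[of "sym_group d" S] by (simp add: sym_group_one)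
  have prod: "foldr (\<circ>) T' id \<in> ?G" if "set T' \<subseteq> S" for T'
    using that by (induction T') (auto intro: mult one generate.incl)
  have "foldr (\<circ>) (rev T) id \<circ> \<sigma> = ?c"
    unfolding eq foldr_transpositions(2)[OF T]
    by (simp add: comp_assoc[symmetric] permutes_inv_o(2)[OF foldr_transpositions(1)[OF T]])
  moreover have "foldr (\<circ>) (rev T) id \<circ> \<sigma> \<in> ?G"
    using TS \<sigma> by (intro mult prod generate.incl) auto
  ultimately have "?c \<in> ?G" by simp
  then have pow: "?c ^^ n \<in> ?G" for n
    by (induction n) (auto intro: mult one)
  show ?thesis unfolding generates_transitive_def
  proof (intro ballI)
    fix x y assume "x \<in> {1..d}" "y \<in> {1..d}"
    then have "y \<in> Orbits.orbit ?c x" using orbit_interval_cycle[of x 0 d] by simp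
    then obtain n where "y = (?c ^^ n) x" unfolding orbit_altdef by blast
    then show "\<exists>h\<in>?G. h x = y" using pow by blast
  qed
qed

text \<open>
  The hypothesis \<open>d \<ge> 2 \<or> g = 0\<close> is exactly what provides a transposition to fill the \<open>2 * g\<close>
  places that the factorisations of \<open>\<sigma>\<close> and \<open>\<delta>\<close> leave free.
\<close>

lemma hurwitz_tuples_nonempty:
  assumes "d \<ge> 1" "is_partition_of \<alpha> d" "is_partition_of \<beta> d" "d \<ge> 2 \<or> g = 0"
  shows "hurwitz_tuples d g \<alpha> \<beta> \<noteq> {}"
proof -
  have \<alpha>: "\<alpha> \<noteq> {#}" "0 \<notin># \<alpha>" "sum_mset \<alpha> = d"
    using assms(1,2) unfolding is_partition_of_def by fastforce+
  have \<beta>: "\<beta> \<noteq> {#}" "0 \<notin># \<beta>" "sum_mset \<beta> = d"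
    using assms(1,3) unfolding is_partition_of_def by fastforce+
  let ?c = "interval_cycle 0 d"
  obtain \<sigma> A where \<sigma>: "\<sigma> \<in> perms_of_type d \<alpha>" and A: "set A \<subseteq> transpositions d"
    and lenA: "Suc (length A) = size \<alpha>" and eqA: "\<sigma> = foldr (\<circ>) A id \<circ> ?c"
    using factor_long_cycle[OF \<alpha>(1,2)] \<alpha>(3) by auto
  obtain \<delta> B where \<delta>: "\<delta> \<in> perms_of_type d \<beta>" and B: "set B \<subseteq> transpositions d"
    and lenB: "Suc (length B) = size \<beta>" and eqB: "\<delta> = foldr (\<circ>) B id \<circ> ?c"
    using factor_long_cycle[OF \<beta>(1,2)] \<beta>(3) by auto
  define E where "E = replicate (2 * g) (transpose 1 (2 :: nat))"
  have E: "set E \<subseteq> transpositions d"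
  proof (cases "g = 0")
    case False
    then have "(1 :: nat) \<in> {1..d}" "2 \<in> {1..d}" "(1 :: nat) \<noteq> 2" using assms(4) by auto
    then show ?thesis unfolding E_def transpositions_def by fastforce
  qed (simp add: E_def)
  have prodE: "foldr (\<circ>) E id = id"
    unfolding E_def by (induction g) (auto simp: comp_assoc[symmetric])
  define \<pi>s where "\<pi>s = B @ rev A @ E"
  let ?a = "foldr (\<circ>) A id" and ?b = "foldr (\<circ>) B id"
  have perms: "?a permutes {1..d}" "?b permutes {1..d}" "?c permutes {1..d}"
    using foldr_transpositions(1)[OF A] foldr_transpositions(1)[OF B]
      interval_cycle_permutes[of 0 d] by auto
  have inv_\<delta>: "inv' \<delta> = inv' ?c \<circ> inv' ?b"
    unfolding eqB using permutes_bij[OF perms(2)] permutes_bij[OF perms(3)] by (rule o_inv_distrib)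
  have "foldr (\<circ>) \<pi>s id = ?b \<circ> inv' ?a"
    unfolding \<pi>s_def foldr_comp_append prodE foldr_transpositions(2)[OF A] by simp
  then have "\<sigma> \<circ> inv' \<delta> \<circ> foldr (\<circ>) \<pi>s id =
      ?a \<circ> (?c \<circ> inv' ?c) \<circ> (inv' ?b \<circ> ?b) \<circ> inv' ?a"
    unfolding inv_\<delta> eqA by (simp add: comp_assoc)
  also have "\<dots> = id"
    by (simp add: permutes_inv_o[OF perms(1)] permutes_inv_o[OF perms(2)]
        permutes_inv_o[OF perms(3)])
  finally have prod: "\<sigma> \<circ> inv' \<delta> \<circ> foldr (\<circ>) \<pi>s id = id" .
  have \<pi>s: "set \<pi>s \<subseteq> transpositions d" using A B E by (auto simp: \<pi>s_def)
  have len: "length \<pi>s = hurwitz_r g \<alpha> \<beta>"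
    using lenA lenB by (auto simp: \<pi>s_def E_def hurwitz_r_def)
  have \<gamma>: "inv' \<delta> \<in> perms_of_type d \<beta>" using \<delta> by (rule inv_perms_of_type)
  have "generates_transitive d ({\<sigma>, inv' \<delta>} \<union> set \<pi>s)"
  proof (rule generates_transitive_long_cycle[OF _ _ _ A eqA])
    show "{\<sigma>, inv' \<delta>} \<union> set \<pi>s \<subseteq> carrier (sym_group d)"
      using \<sigma> \<gamma> \<pi>s transposition_properties(1)
      by (auto simp: perms_of_type_def sym_group_carrier)
  qed (auto simp: \<pi>s_def)
  then have "(\<sigma>, inv' \<delta>, \<pi>s) \<in> hurwitz_tuples d g \<alpha> \<beta>"
    using \<sigma> \<gamma> \<pi>s prod len unfolding hurwitz_tuples_def by blast
  then show ?thesis by blast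
qed

text \<open>
  The trivial group has no nonidentity entries to supply a positive defect.
\<close>

lemma reduced_tuples_degree_one:
  assumes "0 < r"
  shows "reduced_tuples 1 r \<alpha> \<beta> = {}"
proof -
  have "carrier (sym_group 1) = {id}" by (simp add: sym_group_def)
  then show ?thesis using assms by (auto simp: reduced_tuples_def)
qed

section \<open>The leading coefficient\<close>

theorem theorem4p3:
  fixes d g :: nat and \<alpha> \<beta> :: "nat multiset"
  assumes "d \<ge> 1"
    and "is_partition_of \<alpha> d"
    and "is_partition_of \<beta> d"
  shows "\<exists>p :: rat poly.
      (\<forall>m\<ge>1. hypermap_number d g m \<alpha> \<beta> = poly p (of_nat m)) \<and>
      (if d = 1 \<and> g \<ge> 1 then p = 0 else p \<noteq> 0 \<and> degree p = hurwitz_r g \<alpha> \<beta>) \<and>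
      fact (hurwitz_r g \<alpha> \<beta>) * coeff p (hurwitz_r g \<alpha> \<beta>) = double_hurwitz_number d g \<alpha> \<beta>"
proof -
  define r where "r = hurwitz_r g \<alpha> \<beta>"
  define R where "R = reduced_tuples d r \<alpha> \<beta>"
  define K :: rat where "K = 1 / fact d * of_nat (card_Aut \<alpha>) * of_nat (card_Aut \<beta>)"
  define len where "len = (\<lambda>t :: (nat \<Rightarrow> nat) \<times> (nat \<Rightarrow> nat) \<times> (nat \<Rightarrow> nat) list. length (snd (snd t)))"
  define p where "p = smult K (\<Sum>t\<in>R. binomial_poly (len t))"
  have finR: "finite R" unfolding R_def by (rule finite_reduced_tuples)
  have values_m: "hypermap_number d g m \<alpha> \<beta> = poly p (of_nat m)" for m
    unfolding p_def hypermap_number_def card_hypermap_tuples K_def R_def r_def len_def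
    by (simp add: poly_sum poly_binomial_poly)
  have len: "len t \<le> r" if "t \<in> R" for t
    using that length_le_defect by (fastforce simp: R_def reduced_tuples_def len_def)
  have deg: "degree p \<le> r" unfolding p_def
    by (intro order.trans[OF degree_smult_le] degree_sum_le finR)
       (simp add: degree_binomial_poly len)
  have "coeff (binomial_poly (len t)) r = (if len t = r then 1 / fact r else 0)" if "t \<in> R" for t
    using len[OF that] by (auto simp: lead_coeff_binomial_poly degree_binomial_poly intro: coeff_eq_0)
  then have "coeff p r = K * (\<Sum>t\<in>R. if len t = r then 1 / fact r else 0)"
    unfolding p_def by (simp add: coeff_sum)
  also have "\<dots> = K * (\<Sum>t\<in>{t \<in> R. len t = r}. 1 / fact r)"
    by (simp only: sum.inter_filter[OF finR])
  also have "{t \<in> R. len t = r} = hurwitz_tuples d g \<alpha> \<beta>"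
    unfolding hurwitz_tuples_eq_reduced R_def r_def len_def by simp
  finally have coeff_r: "coeff p r = K * of_nat (card (hurwitz_tuples d g \<alpha> \<beta>)) / fact r"
    by simp
  have lead: "fact r * coeff p r = double_hurwitz_number d g \<alpha> \<beta>"
    unfolding coeff_r double_hurwitz_number_def K_def by simp
  have "if d = 1 \<and> g \<ge> 1 then p = 0 else p \<noteq> 0 \<and> degree p = r"
  proof (cases "d = 1 \<and> g \<ge> 1")
    case True
    have "\<alpha> \<noteq> {#}" using assms by (auto simp: is_partition_of_def)
    then have "size \<alpha> > 0" by (simp add: nonempty_has_size)
    then have "0 < r" using True assms by (auto simp: r_def hurwitz_r_def)
    then have "R = {}" using True reduced_tuples_degree_one[of r \<alpha> \<beta>] unfolding R_def by simp
    then show ?thesis using True by (simp add: p_def)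
  next
    case False
    have "hurwitz_tuples d g \<alpha> \<beta> \<noteq> {}"
      using assms False by (intro hurwitz_tuples_nonempty) auto
    moreover have "finite (hurwitz_tuples d g \<alpha> \<beta>)"
      unfolding hurwitz_tuples_eq_reduced by (simp add: finite_reduced_tuples)
    ultimately have "card (hurwitz_tuples d g \<alpha> \<beta>) \<noteq> 0" by simp
    moreover have "K \<noteq> 0" unfolding K_def card_Aut_def by simp
    ultimately have "coeff p r \<noteq> 0" unfolding coeff_r by simp
    then have "p \<noteq> 0" "r \<le> degree p" by (auto intro: le_degree)
    then show ?thesis using False deg by auto
  qed
  then show ?thesis using values_m lead unfolding r_def by blast
qed

end
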